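(* Suppose that $A=(a_{ij})\in\mathbb{R}^{2\times 2}$. Then $A$ is an EP-matrix if and only if $a_{12}a_{21}\ge 0$.
   Context: A matrix in $\mathbb{R}^{n\times n}$ is called a P-matrix if all its principal minors are positive. A matrix $A\in\mathbb{R}^{n\times n}$ is called an EP-matrix (exponential P-matrix) if $\exp(At)$ is a P-matrix for all $t\ge 0$. *)

theory Defs
  imports
    Complex_Main
    "Jordan_Normal_Form.Determinant"
    "Jordan_Normal_Form.DL_Submatrix"
begin

(* The type of matrices carries no topology, so the series is taken entrywise. *)
definition mat_exp :: "real mat \<Rightarrow> real mat" where
  "mat_exp A = mat (dim_row A) (dim_row A) (\<lambda>ij. \<Sum>k. (A ^\<^sub>m k) $$ ij / fact k)"

definition P_matrix :: "real mat \<Rightarrow> bool" where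
  "P_matrix A \<longleftrightarrow> square_mat A \<and>
     (\<forall>I. I \<noteq> {} \<and> I \<subseteq> {..<dim_row A} \<longrightarrow> det (submatrix A I I) > 0)"

definition EP_matrix :: "real mat \<Rightarrow> bool" where
  "EP_matrix A \<longleftrightarrow> square_mat A \<and> (\<forall>t\<ge>0. P_matrix (mat_exp (t \<cdot>\<^sub>m A)))"

lemma pow_mat_entry_bound:
  fixes A :: "real mat"
  assumes A: "A \<in> carrier_mat n n"
    and M: "\<And>i j. i < n \<Longrightarrow> j < n \<Longrightarrow> \<bar>A $$ (i, j)\<bar> \<le> M"
    and ij: "i < n" "j < n"
  shows "\<bar>(A ^\<^sub>m k) $$ (i, j)\<bar> \<le> (real n * M) ^ k"
  using ij
proof (induction k arbitrary: i j)
  case 0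
  then show ?case using A by auto
next
  case (Suc k)
  have M0: "0 \<le> M" using M[OF Suc.prems] by linarith
  have Ak: "A ^\<^sub>m k \<in> carrier_mat n n" using A by (rule pow_carrier_mat)
  have "(A ^\<^sub>m Suc k) $$ (i, j) = (\<Sum>l = 0..<n. (A ^\<^sub>m k) $$ (i, l) * A $$ (l, j))"
    using Suc.prems A Ak by (auto simp: scalar_prod_def)
  also have "\<bar>\<dots>\<bar> \<le> (\<Sum>l = 0..<n. \<bar>(A ^\<^sub>m k) $$ (i, l) * A $$ (l, j)\<bar>)"
    by (rule sum_abs)
  also have "\<dots> \<le> (\<Sum>l = 0..<n. (real n * M) ^ k * M)"
    using Suc M M0 by (intro sum_mono) (auto simp: abs_mult intro!: mult_mono)
  also have "\<dots> = (real n * M) ^ Suc k" by simp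
  finally show ?case .
qed

(* The defining series always converges, so suminf is never applied outside its domain. *)
lemma mat_exp_sums:
  assumes A: "A \<in> carrier_mat n n" and ij: "i < n" "j < n"
  shows "(\<lambda>k. (A ^\<^sub>m k) $$ (i, j) / fact k) sums (mat_exp A $$ (i, j))"
proof -
  define M where "M = (\<Sum>p\<in>{..<n} \<times> {..<n}. \<bar>A $$ p\<bar>)"
  have M: "\<bar>A $$ (i, j)\<bar> \<le> M" if "i < n" "j < n" for i j
    unfolding M_def using that by (intro member_le_sum) auto
  have "summable (\<lambda>k. (A ^\<^sub>m k) $$ (i, j) / fact k)"
  proof (rule summable_comparison_test')
    show "summable (\<lambda>k. inverse (fact k) * (real n * M) ^ k)" by (rule summable_exp)
    show "norm ((A ^\<^sub>m k) $$ (i, j) / fact k) \<le> inverse (fact k) * (real n * M) ^ k"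
      if "k \<ge> 0" for k
      using pow_mat_entry_bound[OF A M ij, of k] by (simp add: divide_simps)
  qed
  then show ?thesis using A ij by (simp add: mat_exp_def summable_sums)
qed

end

(* Put m = (a11 + a22) / 2, h = (a11 - a22) / 2 and N = A - m I, so that N^2 = q I with
   q = h^2 + a12 a21.  Then exp (t A) = e^(m t) (C I + S N), where (C, S) is
   (cosh (s t), sinh (s t) / s) for q = s^2 > 0, (1, t) for q = 0, and
   (cos (w t), sin (w t) / w) for q = - w^2 < 0.  The determinant is always positive, so only the
   signs of C + h S and C - h S matter.  If a12 a21 >= 0, then |h| <= s and both are at least
   e^(- s t).  If a12 a21 < 0, one of them is nonpositive at t = pi / w when q < 0, at t = 1 / |h|
   when q = 0, and at the t with e^(2 s t) = (|h| + s) / (|h| - s) when q > 0. *)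
theory Submission
  imports Defs
begin

section \<open>Scalar invariants of a 2 by 2 matrix\<close>

definition half_trace :: "real mat \<Rightarrow> real" where
  "half_trace A = (A $$ (0, 0) + A $$ (1, 1)) / 2"

definition half_diff :: "real mat \<Rightarrow> real" where
  "half_diff A = (A $$ (0, 0) - A $$ (1, 1)) / 2"

text \<open>A quarter of the discriminant of the characteristic polynomial: the eigenvalues are
  \<open>half_trace A\<close> plus or minus its square root.\<close>

definition quarter_disc :: "real mat \<Rightarrow> real" where
  "quarter_disc A = (half_diff A)\<^sup>2 + A $$ (0, 1) * A $$ (1, 0)"

lemma
  assumes "A \<in> carrier_mat 2 2"
  shows half_diff_smult: "half_diff (t \<cdot>\<^sub>m A) = t * half_diff A"
    and quarter_disc_smult: "quarter_disc (t \<cdot>\<^sub>m A) = t\<^sup>2 * quarter_disc A"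
  using assms
  by (simp_all add: half_diff_def quarter_disc_def power2_eq_square field_simps)

section \<open>Principal minors\<close>

lemma submatrix_singleton:
  assumes "i < dim_row A" "j < dim_col A"
  shows "submatrix A {i} {j} = mat 1 1 (\<lambda>_. A $$ (i, j))"
proof -
  have "{k. k < dim_row A \<and> k \<in> {i}} = {i}" "{k. k < dim_col A \<and> k \<in> {j}} = {j}"
    using assms by auto
  moreover have "pick {k} 0 = k" for k by (simp add: Least_equality)
  ultimately show ?thesis by (intro eq_matI) (auto simp: submatrix_def)
qed

lemma submatrix_lessThan:
  assumes "A \<in> carrier_mat n m"
  shows "submatrix A {..<n} {..<m} = A"
proof -
  \<comment> \<open>\<open>pick\<close> lists a set in increasing order, and exactly i elements of
    \<open>{..<k}\<close> lie below i.\<close>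
  have "pick {..<k} i = i" if "i < k" for i k :: nat
    using that pick_card_in_set[of i "{..<k}"]
    by (metis Collect_conj_eq Int_absorb2 Collect_mem_eq card_Collect_less_nat lessThan_def lessThan_iff
        lessThan_subset_iff less_imp_le inf_commute)
  moreover have "{i. i < n \<and> i \<in> {..<n}} = {..<n}" "{i. i < m \<and> i \<in> {..<m}} = {..<m}" by auto
  ultimately show ?thesis using assms by (intro eq_matI) (auto simp: submatrix_def)
qed

lemma det_2:
  fixes A :: "'a :: comm_ring_1 mat"
  assumes A: "A \<in> carrier_mat 2 2"
  shows "det A = A $$ (0, 0) * A $$ (1, 1) - A $$ (0, 1) * A $$ (1, 0)"
proof -
  have "det (mat_delete A 0 j) = A $$ (1, 1 - j)" if "j < 2" for j
    using A that det_single[of "mat_delete A 0 j"]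
    by (auto simp: mat_delete_def numeral_2_eq_2 less_Suc_eq)
  then show ?thesis
    using laplace_expansion_row[OF A, of 0]
    by (simp add: cofactor_def numeral_2_eq_2)
qed

lemma P_matrix_2_iff:
  assumes A: "A \<in> carrier_mat 2 2"
  shows "P_matrix A \<longleftrightarrow> A $$ (0, 0) > 0 \<and> A $$ (1, 1) > 0 \<and>
    A $$ (0, 0) * A $$ (1, 1) - A $$ (0, 1) * A $$ (1, 0) > 0"
proof -
  have "{..<2::nat} = {0, 1}" by auto
  then have "I \<noteq> {} \<and> I \<subseteq> {..<2::nat} \<longleftrightarrow> I = {0} \<or> I = {1} \<or> I = {..<2}" for I
    by auto
  moreover have "det (submatrix A {i} {i}) = A $$ (i, i)" if "i < 2" for i
    using that A by (simp add: submatrix_singleton det_single)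
  moreover have "det (submatrix A {..<2} {..<2}) =
      A $$ (0, 0) * A $$ (1, 1) - A $$ (0, 1) * A $$ (1, 0)"
    using det_2[OF A] submatrix_lessThan[OF A] by simp
  ultimately show ?thesis
    using A by (auto simp: P_matrix_def)
qed

section \<open>Powers and exponential in the basis I, N\<close>

text \<open>f and g are the coordinates in A^k = f k I + g k N; the recurrences come from
  multiplying by A = m I + N with N^2 = q I. They stay abstract so that each sign of q can supply
  its own closed form.\<close>

lemma pow_mat_2:
  assumes A: "A \<in> carrier_mat 2 2"
    and f: "f 0 = 1" "\<And>k. f (Suc k) = half_trace A * f k + quarter_disc A * g k"
    and g: "g 0 = 0" "\<And>k. g (Suc k) = f k + half_trace A * g k"
    and ij: "i < 2" "j < 2"
  shows "(A ^\<^sub>m k) $$ (i, j) =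
    of_bool (i = j) * f k + g k * (A $$ (i, j) - of_bool (i = j) * half_trace A)"
  using ij
proof (induction k arbitrary: i j)
  case 0
  then show ?case using A f g by simp
next
  case (Suc k)
  have "A ^\<^sub>m k \<in> carrier_mat 2 2" using A by (rule pow_carrier_mat)
  then have "(A ^\<^sub>m Suc k) $$ (i, j) = (\<Sum>l\<in>{0, 1}. (A ^\<^sub>m k) $$ (i, l) * A $$ (l, j))"
    using Suc.prems A by (simp add: scalar_prod_def numeral_2_eq_2)
  moreover have "i = 0 \<or> i = 1" "j = 0 \<or> j = 1" using Suc.prems by auto
  ultimately show ?case
    by (auto simp: Suc.IH f g half_trace_def half_diff_def quarter_disc_def power2_eq_square field_simps)
qed

lemma mat_exp_2:
  assumes A: "A \<in> carrier_mat 2 2"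
    and f: "f 0 = 1" "\<And>k. f (Suc k) = half_trace A * f k + quarter_disc A * g k"
    and g: "g 0 = 0" "\<And>k. g (Suc k) = f k + half_trace A * g k"
    and F: "(\<lambda>k. f k / fact k) sums (exp (half_trace A) * C)"
    and G: "(\<lambda>k. g k / fact k) sums (exp (half_trace A) * S)"
    and ij: "i < 2" "j < 2"
  shows "mat_exp A $$ (i, j) =
    exp (half_trace A) * (of_bool (i = j) * C + S * (A $$ (i, j) - of_bool (i = j) * half_trace A))"
proof -
  let ?d = "of_bool (i = j) :: real" and ?m = "half_trace A"
  have "(\<lambda>k. ?d * (f k / fact k) + (g k / fact k) * (A $$ (i, j) - ?d * ?m)) sums
      (?d * (exp ?m * C) + exp ?m * S * (A $$ (i, j) - ?d * ?m))"
    by (intro sums_add sums_mult sums_mult2 F G)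
  also have "(\<lambda>k. ?d * (f k / fact k) + (g k / fact k) * (A $$ (i, j) - ?d * ?m)) =
      (\<lambda>k. (A ^\<^sub>m k) $$ (i, j) / fact k)"
    by (rule ext) (simp add: pow_mat_2[where f = f and g = g, OF A f g ij] add_divide_distrib)
  finally show ?thesis
    using mat_exp_sums[OF A ij] by (auto dest: sums_unique2 simp: algebra_simps)
qed

text \<open>Since det (C I + S N) = C^2 - q S^2, the assumption \<open>det\<close> makes det (exp A)
  = e^(2 m) positive. What remains are the diagonal entries, and those of N are h and - h.\<close>

lemma P_matrix_mat_exp_2_iff:
  assumes A: "A \<in> carrier_mat 2 2"
    and f: "f 0 = 1" "\<And>k. f (Suc k) = half_trace A * f k + quarter_disc A * g k"
    and g: "g 0 = 0" "\<And>k. g (Suc k) = f k + half_trace A * g k"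
    and F: "(\<lambda>k. f k / fact k) sums (exp (half_trace A) * C)"
    and G: "(\<lambda>k. g k / fact k) sums (exp (half_trace A) * S)"
    and det: "C\<^sup>2 - quarter_disc A * S\<^sup>2 = 1"
  shows "P_matrix (mat_exp A) \<longleftrightarrow> C + half_diff A * S > 0 \<and> C - half_diff A * S > 0"
proof -
  let ?e = "exp (half_trace A)"
  note entry = mat_exp_2[OF A f g F G]
  have E: "mat_exp A \<in> carrier_mat 2 2" using A by (simp add: mat_exp_def)
  have e00: "mat_exp A $$ (0, 0) = ?e * (C + half_diff A * S)"
    by (simp add: entry) (simp add: half_trace_def half_diff_def field_simps)
  have e11: "mat_exp A $$ (1, 1) = ?e * (C - half_diff A * S)"
    by (simp add: entry[of 1 1, simplified]) (simp add: half_trace_def half_diff_def field_simps)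
  have e01: "mat_exp A $$ (0, 1) = ?e * (S * A $$ (0, 1))" by (simp add: entry)
  have e10: "mat_exp A $$ (1, 0) = ?e * (S * A $$ (1, 0))" by (simp add: entry)
  have "mat_exp A $$ (0, 0) * mat_exp A $$ (1, 1) - mat_exp A $$ (0, 1) * mat_exp A $$ (1, 0) =
      ?e\<^sup>2 * (C\<^sup>2 - quarter_disc A * S\<^sup>2)"
    unfolding e00 e11 e01 e10 quarter_disc_def by (simp add: power2_eq_square algebra_simps)
  then show ?thesis
    using P_matrix_2_iff[OF E] det e00 e11 by (simp add: zero_less_mult_iff)
qed

section \<open>Closed forms by the sign of the discriminant\<close>

lemma exp_sums_real: "(\<lambda>k. x ^ k / fact k) sums exp (x :: real)"
  using exp_converges[of x] by (simp add: divide_inverse mult.commute)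

lemma P_matrix_mat_exp_hyperbolic:
  assumes A: "A \<in> carrier_mat 2 2" and q: "quarter_disc A = s\<^sup>2" and s: "s \<noteq> 0"
  shows "P_matrix (mat_exp A) \<longleftrightarrow>
    cosh s + half_diff A * (sinh s / s) > 0 \<and> cosh s - half_diff A * (sinh s / s) > 0"
proof (rule P_matrix_mat_exp_2_iff[OF A])
  let ?m = "half_trace A"
  \<comment> \<open>N has eigenvalues s and - s, so f + s g and f - s g must be the powers of the
    eigenvalues m + s and m - s of A.\<close>
  let ?f = "\<lambda>k. ((?m + s) ^ k + (?m - s) ^ k) / 2"
  let ?g = "\<lambda>k. ((?m + s) ^ k - (?m - s) ^ k) / (2 * s)"
  show "?f 0 = 1" "?g 0 = 0" by simp_all
  show "?f (Suc k) = ?m * ?f k + quarter_disc A * ?g k" "?g (Suc k) = ?f k + ?m * ?g k" for k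
    using s by (simp_all add: q power2_eq_square field_simps)
  have "(\<lambda>k. ((?m + s) ^ k / fact k + (?m - s) ^ k / fact k) / 2) sums
      ((exp (?m + s) + exp (?m - s)) / 2)"
    by (intro sums_add sums_divide exp_sums_real)
  moreover have "(exp (?m + s) + exp (?m - s)) / 2 = exp ?m * cosh s"
    by (simp add: cosh_def exp_add exp_diff exp_minus field_simps)
  ultimately show "(\<lambda>k. ?f k / fact k) sums (exp ?m * cosh s)"
    by (simp add: add_divide_distrib mult.commute)
  have "(\<lambda>k. ((?m + s) ^ k / fact k - (?m - s) ^ k / fact k) / (2 * s)) sums
      ((exp (?m + s) - exp (?m - s)) / (2 * s))"
    by (intro sums_diff sums_divide exp_sums_real)
  moreover have "(exp (?m + s) - exp (?m - s)) / (2 * s) = exp ?m * (sinh s / s)"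
    using s by (simp add: sinh_def exp_add exp_diff exp_minus field_simps)
  ultimately show "(\<lambda>k. ?g k / fact k) sums (exp ?m * (sinh s / s))"
    by (simp add: diff_divide_distrib mult.commute)
  show "(cosh s)\<^sup>2 - quarter_disc A * (sinh s / s)\<^sup>2 = 1"
    using s by (simp add: q power_divide cosh_square_eq)
qed

lemma P_matrix_mat_exp_parabolic:
  assumes A: "A \<in> carrier_mat 2 2" and q: "quarter_disc A = 0"
  shows "P_matrix (mat_exp A) \<longleftrightarrow> 1 + half_diff A > 0 \<and> 1 - half_diff A > 0"
proof -
  let ?m = "half_trace A"
  \<comment> \<open>The derivative of m^k in m, the limit of the divided difference of the
    hyperbolic case. At k = 0 the factor 0 absorbs the truncated exponent.\<close>
  let ?g = "\<lambda>k. of_nat k * ?m ^ (k - 1)"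
  have g: "?g (Suc k) = ?m ^ k + ?m * ?g k" for k
    by (cases k) (simp_all add: algebra_simps)
  \<comment> \<open>The factor k + 1 cancels against (k + 1)!, which leaves the exponential series;
    the omitted term at 0 vanishes.\<close>
  have "(\<lambda>k. ?g (Suc k) / fact (Suc k)) sums exp ?m"
    using exp_sums_real[of ?m] by (simp add: fact_Suc del: of_nat_Suc)
  then have "(\<lambda>k. ?g k / fact k) sums (exp ?m)"
    by (subst (asm) sums_Suc_iff) simp
  then show ?thesis
    using P_matrix_mat_exp_2_iff[OF A, of "\<lambda>k. ?m ^ k" ?g 1 1] g exp_sums_real[of ?m]
    by (simp add: q)
qed

lemma P_matrix_mat_exp_elliptic:
  assumes A: "A \<in> carrier_mat 2 2" and q: "quarter_disc A = - w\<^sup>2" and w: "w \<noteq> 0"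
  shows "P_matrix (mat_exp A) \<longleftrightarrow>
    cos w + half_diff A * (sin w / w) > 0 \<and> cos w - half_diff A * (sin w / w) > 0"
proof (rule P_matrix_mat_exp_2_iff[OF A])
  let ?m = "half_trace A"
  \<comment> \<open>An eigenvalue of A. Its powers are f + i w g, so the recurrences are
    multiplication by z, and the series are the real and imaginary parts of e^z.\<close>
  let ?z = "Complex ?m w"
  let ?f = "\<lambda>k. Re (?z ^ k)"
  let ?g = "\<lambda>k. Im (?z ^ k) / w"
  show "?f 0 = 1" "?g 0 = 0" by simp_all
  show "?f (Suc k) = ?m * ?f k + quarter_disc A * ?g k" "?g (Suc k) = ?f k + ?m * ?g k" for k
    using w by (simp_all add: q power2_eq_square field_simps)
  show "(\<lambda>k. ?f k / fact k) sums (exp ?m * cos w)"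
    using sums_Re[OF exp_converges[of ?z]] by (simp add: Re_exp divide_inverse mult.commute)
  show "(\<lambda>k. ?g k / fact k) sums (exp ?m * (sin w / w))"
    using sums_divide[OF sums_Im[OF exp_converges[of ?z]], of w]
    by (simp add: Im_exp divide_inverse mult_ac)
  show "(cos w)\<^sup>2 - quarter_disc A * (sin w / w)\<^sup>2 = 1"
    using w by (simp add: q power_divide)
qed

section \<open>The two directions of the equivalence\<close>

text \<open>Time 1 suffices, because scaling A by t multiplies the off-diagonal product by t^2. The
  bound \<bar>h\<bar> \<le> s then reduces the claim to sinh s < cosh s, or to h = 0 when s =
  0.\<close>

lemma P_matrix_mat_exp_if_nonneg:
  assumes A: "A \<in> carrier_mat 2 2" and nn: "A $$ (0, 1) * A $$ (1, 0) \<ge> 0"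
  shows "P_matrix (mat_exp A)"
proof -
  define s where "s = sqrt (quarter_disc A)"
  have q: "quarter_disc A = s\<^sup>2" using nn by (simp add: s_def quarter_disc_def)
  have h: "\<bar>half_diff A\<bar> \<le> s"
    unfolding s_def by (rule real_le_rsqrt) (use nn in \<open>simp add: quarter_disc_def\<close>)
  show ?thesis
  proof (cases "s = 0")
    case True
    then show ?thesis using P_matrix_mat_exp_parabolic[OF A] q h by simp
  next
    case False
    then have s: "s > 0" using h by linarith
    have "\<bar>half_diff A * (sinh s / s)\<bar> = \<bar>half_diff A\<bar> / s * sinh s"
      using s by (simp add: abs_mult)
    also have "\<dots> \<le> 1 * sinh s"
      using s h by (intro mult_right_mono) simp_all
    also have "\<dots> < cosh s" by (simp add: sinh_less_cosh_real)
    finally have "\<bar>half_diff A * (sinh s / s)\<bar> < cosh s" .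
    then show ?thesis
      unfolding P_matrix_mat_exp_hyperbolic[OF A q False] by linarith
  qed
qed

lemma tanh_artanh_real:
  fixes x :: real
  assumes "\<bar>x\<bar> < 1"
  shows "tanh (artanh x) = x"
proof -
  \<comment> \<open>The exponent - 2 y is the one in tanh y = (1 - e^(- 2 y)) / (1 + e^(- 2
    y)).\<close>
  have "- 2 * artanh x = - ln ((1 + x) / (1 - x))"
    by (simp add: artanh_def)
  then have "exp (- 2 * artanh x) = (1 - x) / (1 + x)"
    using assms by (simp only: exp_minus) (simp add: abs_less_iff)
  moreover have "1 + x \<noteq> 0" using assms by auto
  ultimately show ?thesis
    by (simp only: tanh_real_altdef) (simp add: divide_simps)
qed

lemma not_P_matrix_mat_exp_if_neg:
  assumes A: "A \<in> carrier_mat 2 2" and neg: "A $$ (0, 1) * A $$ (1, 0) < 0"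
  shows "\<exists>t\<ge>0. \<not> P_matrix (mat_exp (t \<cdot>\<^sub>m A))"
proof -
  have tA: "t \<cdot>\<^sub>m A \<in> carrier_mat 2 2" for t using A by simp
  let ?h = "half_diff A" and ?q = "quarter_disc A"
  consider "?q < 0" | "?q = 0" | "?q > 0" by linarith
  then show ?thesis
  proof cases
    case 1
    define w where "w = sqrt (- ?q)"
    have w: "w > 0" "?q = - w\<^sup>2" using 1 by (simp_all add: w_def)
    \<comment> \<open>Here the sine vanishes and the cosine is - 1, so both diagonal entries are
      negative.\<close>
    let ?t = "pi / w"
    have "quarter_disc (?t \<cdot>\<^sub>m A) = - pi\<^sup>2"
      using w by (simp add: quarter_disc_smult[OF A] power_divide)
    from P_matrix_mat_exp_elliptic[OF tA this] have "\<not> P_matrix (mat_exp (?t \<cdot>\<^sub>m A))" by simp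
    then show ?thesis using w by (intro exI[of _ ?t]) simp
  next
    case 2
    then have h: "?h \<noteq> 0" using neg by (auto simp: quarter_disc_def)
    \<comment> \<open>This scales h to 1 or - 1, so one of 1 + h and 1 - h becomes 0.\<close>
    let ?t = "1 / \<bar>?h\<bar>"
    have "quarter_disc (?t \<cdot>\<^sub>m A) = 0" using 2 by (simp add: quarter_disc_smult[OF A])
    from P_matrix_mat_exp_parabolic[OF tA this] have "\<not> P_matrix (mat_exp (?t \<cdot>\<^sub>m A))"
      using h by (auto simp: half_diff_smult[OF A] abs_if)
    then show ?thesis by (intro exI[of _ ?t]) simp
  next
    case 3
    define s where "s = sqrt ?q"
    have s: "s > 0" "?q = s\<^sup>2" using 3 by (simp_all add: s_def)
    have "s\<^sup>2 < \<bar>?h\<bar>\<^sup>2" using neg s(2) by (simp add: quarter_disc_def)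
    then have hs: "s < \<bar>?h\<bar>" by (rule power2_less_imp_less) simp
    \<comment> \<open>With r = s t, a diagonal entry vanishes when cosh r = (\<bar>h\<bar> / s) sinh
      r, that is tanh r = s / \<bar>h\<bar>. The inequality s < \<bar>h\<bar>, due to a12 a21 < 0,
      makes this solvable.\<close>
    define r where "r = artanh (s / \<bar>?h\<bar>)"
    have r: "tanh r = s / \<bar>?h\<bar>"
      unfolding r_def using s hs by (intro tanh_artanh_real) simp
    then have "tanh r > 0" using s hs by simp
    then have "r > 0" by simp
    let ?t = "r / s"
    have t: "?t > 0" using \<open>r > 0\<close> s by simp
    have "quarter_disc (?t \<cdot>\<^sub>m A) = r\<^sup>2"
      using s by (simp add: quarter_disc_smult[OF A] power_divide)
    note P = P_matrix_mat_exp_hyperbolic[OF tA this]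
    have c: "cosh r = \<bar>?h\<bar> * (sinh r / s)"
      using r s hs by (simp add: tanh_def field_simps)
    have "\<not> P_matrix (mat_exp (?t \<cdot>\<^sub>m A))"
      using P \<open>r > 0\<close> c s by (auto simp: half_diff_smult[OF A] abs_if split: if_splits)
    then show ?thesis using t by (intro exI[of _ ?t]) simp
  qed
qed

theorem proposition1:
  fixes A :: "real mat"
  assumes "A \<in> carrier_mat 2 2"
  shows "EP_matrix A \<longleftrightarrow> A $$ (0, 1) * A $$ (1, 0) \<ge> 0"
proof
  assume "EP_matrix A"
  then show "A $$ (0, 1) * A $$ (1, 0) \<ge> 0"
    using not_P_matrix_mat_exp_if_neg[OF assms] by (force simp: EP_matrix_def)
next
  assume nn: "A $$ (0, 1) * A $$ (1, 0) \<ge> 0"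
  have "P_matrix (mat_exp (t \<cdot>\<^sub>m A))" for t
  proof (rule P_matrix_mat_exp_if_nonneg)
    have "t\<^sup>2 * (A $$ (0, 1) * A $$ (1, 0)) \<ge> 0" using nn by simp
    then show "(t \<cdot>\<^sub>m A) $$ (0, 1) * (t \<cdot>\<^sub>m A) $$ (1, 0) \<ge> 0"
      using assms by (simp add: power2_eq_square mult_ac)
  qed (use assms in simp)
  then show "EP_matrix A" using assms by (simp add: EP_matrix_def)
qed

end
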